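(* Let $m\ge3$, $n\ge m$, and let $G=(V,E)$ be a nontrivial (i.e. $E\neq\emptyset$) $m$-uniform hypergraph with $|V|=n$, coclique number $\omega(G)$ and adjacency tensor $\mathcal{A}$. Then $$\omega(G)^{m-1}\le\min_{\lambda\in\mathbb{N}}\{\lambda : \lambda(\mathcal{A}+\mathcal{I})-\mathcal{E}\in\mathbb{COP}_{m,n}\}.$$
   Context: An $m$-uniform hypergraph $G=(V,E)$ has vertex set $V=\{1,\dots,n\}$ and edge set $E$ of $m$-element subsets of $V$. A coclique is a vertex set none of whose $m$-element subsets is an edge; $\omega(G)$ is the maximum cardinality of a coclique. The adjacency tensor $\mathcal{A}$ of $G$ is the order-$m$, dimension-$n$ tensor with $a_{i_1\cdots i_m}=\frac{1}{(m-1)!}$ if $\{i_1,\dots,i_m\}\in E$ and $0$ otherwise. $\mathcal{I}$ is the identity tensor ($\mathcal{I}_{i_1\cdots i_m}=1$ if $i_1=\cdots=i_m$, else $0$), $\mathcal{E}$ is the all-ones tensor, and $\mathbb{N}$ denotes the set of positive integers. $\mathbb{COP}_{m,n}$ is the cone of copositive symmetric tensors of order $m$ and dimension $n$, i.e. symmetric $\mathcal{T}$ with $\mathcal{T}\mathbf{x}^m=\sum t_{i_1\cdots i_m}x_{i_1}\cdots x_{i_m}\ge0$ for all $\mathbf{x}\in\mathbb{R}^n_+$. *)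

theory Defs
  imports Complex_Main "HOL-Library.Multiset"
begin

subsection \<open>Uniform hypergraphs on the vertex set 1, ..., n\<close>

abbreviation vertices :: "nat \<Rightarrow> nat set" where
  "vertices n \<equiv> {1..n}"

definition uniform_hypergraph :: "nat \<Rightarrow> nat \<Rightarrow> nat set set \<Rightarrow> bool" where
  "uniform_hypergraph m n E \<longleftrightarrow> (\<forall>e\<in>E. e \<subseteq> vertices n \<and> card e = m)"

definition coclique :: "nat \<Rightarrow> nat \<Rightarrow> nat set set \<Rightarrow> nat set \<Rightarrow> bool" where
  "coclique m n E S \<longleftrightarrow> S \<subseteq> vertices n \<and> (\<forall>e. e \<subseteq> S \<and> card e = m \<longrightarrow> e \<notin> E)"

definition coclique_number :: "nat \<Rightarrow> nat \<Rightarrow> nat set set \<Rightarrow> nat" where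
  "coclique_number m n E = Max (card ` {S. coclique m n E S})"

subsection \<open>Tensors\<close>

text \<open>
  A tensor of order m and dimension n is represented by a function on index lists, of which only
  the values on lists of length m with entries in 1, ..., n are ever used.  Likewise a vector
  of dimension n is a function on the naturals restricted to 1, ..., n.
\<close>

type_synonym tensor = "nat list \<Rightarrow> real"

definition tensor_indices :: "nat \<Rightarrow> nat \<Rightarrow> nat list set" where
  "tensor_indices m n = {is. set is \<subseteq> {1..n} \<and> length is = m}"

definition symmetric_tensor :: "nat \<Rightarrow> nat \<Rightarrow> tensor \<Rightarrow> bool" where
  "symmetric_tensor m n T \<longleftrightarrow>
     (\<forall>is\<in>tensor_indices m n. \<forall>js\<in>tensor_indices m n. mset is = mset js \<longrightarrow> T is = T js)"

definition tensor_form :: "nat \<Rightarrow> nat \<Rightarrow> tensor \<Rightarrow> (nat \<Rightarrow> real) \<Rightarrow> real" where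
  "tensor_form m n T x = (\<Sum>is\<in>tensor_indices m n. T is * (\<Prod>i\<leftarrow>is. x i))"

definition COP :: "nat \<Rightarrow> nat \<Rightarrow> tensor set" where
  "COP m n = {T. symmetric_tensor m n T \<and>
                 (\<forall>x. (\<forall>i\<in>{1..n}. 0 \<le> x i) \<longrightarrow> 0 \<le> tensor_form m n T x)}"

definition adjacency_tensor :: "nat \<Rightarrow> nat set set \<Rightarrow> tensor" where
  "adjacency_tensor m E is = (if set is \<in> E then 1 / fact (m - 1) else 0)"

definition identity_tensor :: tensor where
  "identity_tensor is = (if \<forall>i\<in>set is. \<forall>j\<in>set is. i = j then 1 else 0)"

definition ones_tensor :: tensor where
  "ones_tensor is = 1"

definition copositive_multipliers :: "nat \<Rightarrow> nat \<Rightarrow> nat set set \<Rightarrow> nat set" where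
  "copositive_multipliers m n E =
     {l. 0 < l \<and>
         (\<lambda>is. real l * (adjacency_tensor m E is + identity_tensor is) - ones_tensor is) \<in> COP m n}"

end

theory Submission
  imports Defs
begin

text \<open>
  Evaluating the form of \<open>\<lambda>(\<A> + \<I>) - \<E>\<close> at the indicator vector of a coclique of size k gives
  \<open>\<lambda> k - k^m\<close>, because no index list with entries in a coclique has an edge as its set of entries.
  Copositivity therefore forces \<open>\<lambda> \<ge> k^(m-1)\<close>.  That some multiplier exists is
  witnessed by \<open>\<lambda> = n^m\<close>: each of the \<open>n^m\<close> monomials of the all-ones form is at most the m-th power
  of the largest coordinate, which is a summand of the identity form.
\<close>

lemma finite_tensor_indices: "finite (tensor_indices m n)"
  unfolding tensor_indices_def by (rule finite_lists_length_eq) simp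

lemma card_tensor_indices: "card (tensor_indices m n) = n ^ m"
  unfolding tensor_indices_def by (simp add: card_lists_length_eq)

lemma prod_list_map_indicator:
  "(\<Prod>i\<leftarrow>is. if i \<in> S then 1 else 0 :: real) = (if set is \<subseteq> S then 1 else 0)"
  by (induction "is") auto

text \<open>At an indicator vector every monomial is 0 or 1, and it is 1 exactly when all of its
  indices lie in \<open>S\<close>. Only the principal subtensor on \<open>S\<close>
  survives.\<close>

lemma tensor_form_indicator:
  assumes "S \<subseteq> vertices n"
  shows "tensor_form m n T (\<lambda>i. if i \<in> S then 1 else 0)
           = (\<Sum>is | set is \<subseteq> S \<and> length is = m. T is)"
proof -
  have "tensor_form m n T (\<lambda>i. if i \<in> S then 1 else 0)
      = (\<Sum>is\<in>tensor_indices m n. if set is \<subseteq> S then T is else 0)"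
    unfolding tensor_form_def prod_list_map_indicator by (intro sum.cong) auto
  also have "\<dots> = sum T (tensor_indices m n \<inter> {is. set is \<subseteq> S})"
    by (simp add: sum.inter_restrict finite_tensor_indices)
  also have "tensor_indices m n \<inter> {is. set is \<subseteq> S} = {is. set is \<subseteq> S \<and> length is = m}"
    using assms by (auto simp: tensor_indices_def)
  finally show ?thesis .
qed

text \<open>Only constant lists contribute, each with value 1. As \<open>m > 0\<close>, such a list
  is determined by its head, so these lists correspond one to one to the elements of
  \<open>S\<close>.\<close>

lemma sum_identity_tensor:
  assumes "finite S" "m > 0"
  shows "(\<Sum>is | set is \<subseteq> S \<and> length is = m. identity_tensor is) = real (card S)"
proof -
  let ?L = "{is. set is \<subseteq> S \<and> length is = m}"
  have "(\<Sum>is\<in>?L. identity_tensor is) = real (card {is \<in> ?L. \<forall>i\<in>set is. \<forall>j\<in>set is. i = j})"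
    by (simp add: identity_tensor_def sum.If_cases finite_lists_length_eq[OF assms(1)] Int_def)
  also have "{is \<in> ?L. \<forall>i\<in>set is. \<forall>j\<in>set is. i = j} = replicate m ` S" (is "?A = ?B")
  proof
    show "?A \<subseteq> ?B"
    proof
      fix "is" assume is_in: "is \<in> ?A"
      then have "hd is \<in> set is" using assms(2) by (cases "is") auto
      then have "is = replicate m (hd is)" "hd is \<in> S"
        using is_in by (blast intro: replicate_eqI)+
      then show "is \<in> ?B" by blast
    qed
    show "?B \<subseteq> ?A" by auto
  qed
  also have "card (replicate m ` S) = card S"
    using assms(2) by (intro card_image) (auto simp: inj_on_def)
  finally show ?thesis .
qed

text \<open>If \<open>set is\<close> were an edge, uniformity would give it exactly \<open>m\<close>
  elements, and it would be an \<open>m\<close>-subset of the coclique \<open>S\<close> that is an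
  edge.\<close>

lemma adjacency_tensor_coclique:
  assumes "uniform_hypergraph m n E" "coclique m n E S" "set is \<subseteq> S"
  shows "adjacency_tensor m E is = 0"
  using assms by (auto simp: adjacency_tensor_def uniform_hypergraph_def coclique_def)

lemma card_coclique_power_le:
  assumes E: "uniform_hypergraph m n E" and "m > 0"
    and S: "coclique m n E S" "S \<noteq> {}" and l: "l \<in> copositive_multipliers m n E"
  shows "card S ^ (m - 1) \<le> l"
proof -
  let ?T = "\<lambda>is. real l * (adjacency_tensor m E is + identity_tensor is) - ones_tensor is"
  let ?L = "{is. set is \<subseteq> S \<and> length is = m}"
  have sub: "S \<subseteq> vertices n" using S(1) by (simp add: coclique_def)
  then have fin: "finite S" using finite_subset by blast
  have "0 \<le> tensor_form m n ?T (\<lambda>i. if i \<in> S then 1 else 0)"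
    using l by (simp add: copositive_multipliers_def COP_def)
  also have "\<dots> = (\<Sum>is\<in>?L. real l * identity_tensor is - 1)"
    unfolding tensor_form_indicator[OF sub]
    by (intro sum.cong) (auto simp: adjacency_tensor_coclique[OF E S(1)] ones_tensor_def)
  also have "\<dots> = real l * real (card S) - real (card S ^ m)"
    by (simp add: sum_subtractf sum_distrib_left[symmetric] sum_identity_tensor[OF fin \<open>m > 0\<close>]
        card_lists_length_eq[OF fin])
  finally have "card S ^ m \<le> l * card S"
    by (metis diff_ge_0_iff_ge of_nat_le_iff of_nat_mult)
  \<comment> \<open>One factor \<open>card S\<close> is split off on the left in order to be
    cancelled; it is positive because \<open>S\<close> is finite and nonempty.\<close>
  then have "card S ^ (m - 1) * card S \<le> l * card S"
    by (simp only: power_minus_mult[OF \<open>m > 0\<close>])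
  then show ?thesis using S(2) fin by (simp add: card_gt_0_iff)
qed

text \<open>All three tensors depend on an index list only through its set of entries, which
  permuting the list preserves.\<close>

lemma symmetric_multiplier_tensor:
  "symmetric_tensor m n (\<lambda>is. l * (adjacency_tensor m E is + identity_tensor is) - ones_tensor is)"
  unfolding symmetric_tensor_def
proof (intro ballI impI)
  fix "is" js :: "nat list"
  assume "mset is = mset js"
  then have "set is = set js" by (rule mset_eq_setD)
  then show "l * (adjacency_tensor m E is + identity_tensor is) - ones_tensor is
      = l * (adjacency_tensor m E js + identity_tensor js) - ones_tensor js"
    by (simp add: adjacency_tensor_def identity_tensor_def ones_tensor_def)
qed

lemma prod_list_le_power:
  fixes x :: "'a \<Rightarrow> real"
  assumes "\<And>i. i \<in> set is \<Longrightarrow> 0 \<le> x i \<and> x i \<le> M"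
  shows "0 \<le> (\<Prod>i\<leftarrow>is. x i) \<and> (\<Prod>i\<leftarrow>is. x i) \<le> M ^ length is"
  using assms
proof (induction "is")
  case (Cons a "is")
  then have "0 \<le> x a" "x a \<le> M" "0 \<le> (\<Prod>i\<leftarrow>is. x i)" "(\<Prod>i\<leftarrow>is. x i) \<le> M ^ length is" by auto
  then show ?case by (simp add: mult_mono)
qed simp

lemma power_mem_copositive_multipliers:
  assumes "n > 0"
  shows "n ^ m \<in> copositive_multipliers m n E"
proof -
  let ?c = "real (n ^ m)"
  let ?T = "\<lambda>is. ?c * (adjacency_tensor m E is + identity_tensor is) - ones_tensor is"
  have "0 \<le> tensor_form m n ?T x" if x: "\<forall>i\<in>{1..n}. 0 \<le> x i" for x
  proof -
    define M where "M = Max (x ` {1..n})"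
    have "M \<in> x ` {1..n}" unfolding M_def using assms by (intro Max_in) auto
    then obtain j where j: "j \<in> {1..n}" "M = x j" by blast
    have bnd: "0 \<le> (\<Prod>i\<leftarrow>is. x i) \<and> (\<Prod>i\<leftarrow>is. x i) \<le> M ^ m" if "is \<in> tensor_indices m n" for "is"
      using that x prod_list_le_power[of "is" x M] by (fastforce simp: tensor_indices_def M_def)
    have "(\<Sum>is\<in>tensor_indices m n. \<Prod>i\<leftarrow>is. x i) \<le> ?c * M ^ m"
      using sum_bounded_above[of "tensor_indices m n" "\<lambda>is. \<Prod>i\<leftarrow>is. x i" "M ^ m"] bnd
      by (simp add: card_tensor_indices)
    \<comment> \<open>Since \<open>x j\<close> is the largest coordinate, the diagonal term at
      \<open>j\<close> alone already supplies the bound \<open>M ^ m\<close>.\<close>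
    also have "M ^ m = identity_tensor (replicate m j) * (\<Prod>i\<leftarrow>replicate m j. x i)"
      by (simp add: identity_tensor_def j(2))
    also have "\<dots> \<le> (\<Sum>is\<in>tensor_indices m n. identity_tensor is * (\<Prod>i\<leftarrow>is. x i))"
    proof (intro member_le_sum finite_tensor_indices)
      show "replicate m j \<in> tensor_indices m n" using j(1) by (auto simp: tensor_indices_def)
    qed (auto simp: bnd identity_tensor_def)
    \<comment> \<open>The hypergraph enters only here: adjacency entries are nonnegative, so adding
      them cannot decrease the form at a nonnegative vector.\<close>
    also have "\<dots> \<le> (\<Sum>is\<in>tensor_indices m n.
        (adjacency_tensor m E is + identity_tensor is) * (\<Prod>i\<leftarrow>is. x i))"
      using bnd by (intro sum_mono mult_right_mono) (auto simp: adjacency_tensor_def)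
    finally have "(\<Sum>is\<in>tensor_indices m n. \<Prod>i\<leftarrow>is. x i) \<le> ?c * (\<Sum>is\<in>tensor_indices m n.
        (adjacency_tensor m E is + identity_tensor is) * (\<Prod>i\<leftarrow>is. x i))"
      by (simp add: mult_left_mono)
    then show ?thesis
      by (simp only: tensor_form_def ones_tensor_def left_diff_distrib sum_subtractf mult.assoc
          sum_distrib_left mult_1 diff_ge_0_iff_ge)
  qed
  then show ?thesis
    using assms symmetric_multiplier_tensor by (simp add: copositive_multipliers_def COP_def)
qed

text \<open>The maximum is taken over a finite set that is nonempty: since \<open>m > 0\<close>, the
  empty set has no \<open>m\<close>-subset and is a coclique.\<close>

lemma coclique_number_attained:
  assumes "m > 0" "uniform_hypergraph m n E"
  obtains S where "coclique m n E S" "card S = coclique_number m n E"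
proof -
  have "{S. coclique m n E S} \<subseteq> Pow (vertices n)" by (auto simp: coclique_def)
  then have "finite {S. coclique m n E S}" by (rule finite_subset) simp
  moreover have "coclique m n E {}" using assms by (auto simp: coclique_def)
  ultimately have "coclique_number m n E \<in> card ` {S. coclique m n E S}"
    unfolding coclique_number_def by (intro Max_in) auto
  then show ?thesis using that by auto
qed

theorem theorem5p2:
  fixes m n :: nat and E :: "nat set set"
  assumes "m \<ge> 3" and "n \<ge> m"
    and "uniform_hypergraph m n E" and "E \<noteq> {}"
  shows "copositive_multipliers m n E \<noteq> {} \<and>
         coclique_number m n E ^ (m - 1) \<le> (LEAST l. l \<in> copositive_multipliers m n E)"
proof
  have pos: "m > 0" "n > 0" using assms(1,2) by auto
  show "copositive_multipliers m n E \<noteq> {}"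
    using power_mem_copositive_multipliers[OF pos(2)] by blast
  \<comment> \<open>\<open>LEAST\<close> denotes an actual minimum only once some multiplier exists,
    so nonemptiness has to come first.\<close>
  then have l: "(LEAST l. l \<in> copositive_multipliers m n E) \<in> copositive_multipliers m n E"
    by (metis LeastI ex_in_conv)
  obtain S where S: "coclique m n E S" "card S = coclique_number m n E"
    using coclique_number_attained[OF pos(1) assms(3)] by blast
  show "coclique_number m n E ^ (m - 1) \<le> (LEAST l. l \<in> copositive_multipliers m n E)"
  \<comment> \<open>Cancelling \<open>card S\<close> requires a nonempty coclique. For the empty one
    the left side is 0, because the exponent \<open>m - 1\<close> is positive.\<close>
  proof (cases "S = {}")
    case True
    then show ?thesis using S(2) assms(1) by (simp add: power_0_left)
  next
    case False
    then show ?thesis using card_coclique_power_le[OF assms(3) pos(1) S(1) _ l] S(2) by simp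
  qed
qed

end
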